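(* Let $(\Omega,\mu)$ be a measure space, let $\Omega_0\subset\Omega$ be a fixed subset, let $\mathcal{H}$ be an infinite-dimensional Hilbert space over $\mathbb{K}$, and let $\mathcal{F}\equiv(\{F(w)\}_{w\in\Omega},\Theta)$ be a retro $(\Omega,\mu)$-frame for $\mathcal{H}$ with respect to a sequence space $\mathcal{Z}_{\mathfrak{d}}$. For a system $\{G(w)\}_{w\in\Omega}\subset\mathcal{H}$ write $\mathcal{A}_d=\{\{\langle y,G(w)\rangle\}_{w\in\Omega}: y\in\mathcal{H}\}$. Then $\mathcal{F}$ has a dual retro $(\Omega,\mu)$-frame (an $\Omega_0$-dual) $(\{G(w)\}_{w\in\Omega},\Theta^\dagger)$ with respect to the corresponding sequence space $\mathcal{A}_d$ if and only if there exists a system $\{G(w)\}_{w\in\Omega}\subset\mathcal{H}$ such that $\langle G(w_0),F(w)\rangle=\delta_{w_0,w}$ for almost all $w\in\Omega$ and almost all $w_0\in\Omega\setminus\Omega_0$, and the analysis operator $\mathcal{U}:y\mapsto\{\langle y,G(w)\rangle\}_{w\in\Omega}$ is a bounded below continuous linear operator from $\mathcal{H}$ onto $\mathcal{A}_d$.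
   Context: $\mathbb{K}=\mathbb{R}$ or $\mathbb{C}$. A system $\{F(w)\}$ is a family of vectors of $\mathcal{H}$ indexed by $w\in\Omega$; "almost all" refers to $\mu$. $\delta_{w_0,w}$ is the Kronecker delta ($1$ if $w_0=w$, $0$ otherwise). A "sequence indexed by $\Omega$" is a scalar-valued function on $\Omega$. The space $\mathcal{A}_d$ is normed by $\|\{\langle y,G(w)\rangle\}\|^2=\int_\Omega|\langle y,G(w)\rangle|^2\,d\mu(w)$ (functions equal $\mu$-almost everywhere being identified). $\mathcal{U}$ is bounded below if there is $c>0$ with $\|\mathcal{U}(y)\|\ge c\|y\|$ for all $y\in\mathcal{H}$. Retro $(\Omega,\mu)$-frame: a pair $\mathcal{F}\equiv(\{F(w)\}_{w\in\Omega},\Theta)$ with $\{F(w)\}_{w\in\Omega}\subset\mathcal{H}$ and $\Theta:\mathcal{Z}_d\to\mathcal{H}$, where $\mathcal{Z}_d$ is a Hilbert space of scalar-valued sequences indexed by $\Omega$ (the associated sequence space), is a retro $(\Omega,\mu)$-frame for $\mathcal{H}$ with respect to $\mathcal{Z}_d$ if: (i) $\{\langle x,F(w)\rangle\}_{w\in\Omega}\in\mathcal{Z}_d$ for each $x\in\mathcal{H}$; (ii) there exist constants $0<A_0\le B_0<\infty$ such that $A_0\|x\|^2\le\int_\Omega|\langle x,F(w)\rangle|^2\,d\mu(w)\le B_0\|x\|^2$ for each $x\in\mathcal{H}$; (iii) $\Theta$ is a bounded linear operator with $\Theta(\{\langle x,F(w)\rangle\}_{w\in\Omega})=x$ for all $x\in\mathcal{H}$.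 The operator $\Theta$ is called the reconstruction operator. Dual: let $\mathcal{F}\equiv(\{F(w)\},\Theta)$ be a retro $(\Omega,\mu)$-frame for $\mathcal{H}$ and let $\Omega_0$ be a fixed subset of $\Omega$. A system $\{G(w)\}_{w\in\Omega}\subset\mathcal{H}$ is a dual retro $(\Omega,\mu)$-frame of $\mathcal{F}$ (an $\Omega_0$-dual) if (i) $\langle G(w_0),F(w)\rangle=\delta_{w_0,w}$ for almost all $w\in\Omega$ and almost all $w_0\in\Omega\setminus\Omega_0$; and (ii) there exists a reconstruction operator $\Theta^\dagger$ such that $(\{G(w)\},\Theta^\dagger)$ is a retro $(\Omega,\mu)$-frame for $\mathcal{H}$. It is a dual with respect to a sequence space $\mathcal{A}_d$ if $(\{G(w)\},\Theta^\dagger)$ is a retro $(\Omega,\mu)$-frame with respect to $\mathcal{A}_d$. *)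

theory Defs
  imports "HOL-Analysis.Analysis"
begin

section \<open>The scalar field\<close>

text \<open>
  The class \<open>rc_field\<close> stands for ``\<open>\<real>\<close> or \<open>\<complex>\<close>'', with its conjugation. Both are shown to be
  instances; by the Gelfand--Mazur theorem there are no others up to isomorphism.
\<close>

class rc_field = real_normed_field + banach + second_countable_topology +
  fixes rc_cnj :: "'a \<Rightarrow> 'a"
  assumes rc_cnj_add: "rc_cnj (x + y) = rc_cnj x + rc_cnj y"
    and rc_cnj_mult: "rc_cnj (x * y) = rc_cnj x * rc_cnj y"
    and rc_cnj_rc_cnj: "rc_cnj (rc_cnj x) = x"
    and mult_rc_cnj_self: "x * rc_cnj x = (norm x)\<^sup>2 *\<^sub>R 1"

instantiation real :: rc_field
begin
definition rc_cnj_real :: "real \<Rightarrow> real" where "rc_cnj_real x = x"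
instance by standard (auto simp: rc_cnj_real_def power2_eq_square)
end

instantiation complex :: rc_field
begin
definition rc_cnj_complex :: "complex \<Rightarrow> complex" where "rc_cnj_complex x = cnj x"
instance
proof
  fix x :: complex
  show "x * rc_cnj x = (norm x)\<^sup>2 *\<^sub>R 1"
    by (simp only: rc_cnj_complex_def scaleR_conv_of_real complex_norm_square mult_1_right)
qed (simp_all add: rc_cnj_complex_def)
end

section \<open>Hilbert spaces over \<open>\<real>\<close> or \<open>\<complex>\<close>\<close>

text \<open>
  Norm, metric and completeness are those of the class \<open>banach\<close>; the inner product is
  linear in its first argument.
\<close>

locale hilbert_space = vector_space smul
  for smul :: "'k::rc_field \<Rightarrow> 'h::banach \<Rightarrow> 'h" +
  fixes ip :: "'h \<Rightarrow> 'h \<Rightarrow> 'k"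
  assumes scale_of_real: "smul (of_real r) x = r *\<^sub>R x"
    and ip_add_left: "ip (x + y) z = ip x z + ip y z"
    and ip_scale_left: "ip (smul a x) y = a * ip x y"
    and ip_conj: "ip y x = rc_cnj (ip x y)"
    and ip_self: "ip x x = of_real ((norm x)\<^sup>2)"

lemma hilbert_space_real_inner:
  "hilbert_space scaleR (inner :: 'h::{real_inner, banach} \<Rightarrow> 'h \<Rightarrow> real)"
proof unfold_locales
  fix x y :: 'h
  show "inner y x = rc_cnj (inner x y)"
    unfolding rc_cnj_real_def by (rule inner_commute)
qed (simp_all add: scaleR_add_right scaleR_add_left inner_add_left power2_norm_eq_inner)

lemma hilbert_space_complex:
  "hilbert_space (*) (\<lambda>x y :: complex. x * rc_cnj y)"
proof unfold_locales
  fix x y z a b :: complex and r :: real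
  show "of_real r * x = r *\<^sub>R x"
    by (simp only: scaleR_conv_of_real)
  show "(x + y) * rc_cnj z = x * rc_cnj z + y * rc_cnj z"
    by (rule distrib_right)
  show "a * x * rc_cnj y = a * (x * rc_cnj y)"
    by (rule mult.assoc)
  show "y * rc_cnj x = rc_cnj (x * rc_cnj y)"
    by (simp only: rc_cnj_mult rc_cnj_rc_cnj mult.commute)
  show "x * rc_cnj x = of_real ((norm x)\<^sup>2)"
    by (simp only: rc_cnj_complex_def complex_norm_square)
qed

definition infinite_dimensional :: "('k::field \<Rightarrow> 'h::ab_group_add \<Rightarrow> 'h) \<Rightarrow> bool" where
  "infinite_dimensional smul \<longleftrightarrow> (\<forall>B. finite B \<longrightarrow> module.span smul B \<noteq> UNIV)"

section \<open>Hilbert spaces of scalar sequences\<close>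

text \<open>
  The index set is \<open>\<Omega> = space M\<close>. A sequence indexed by \<open>\<Omega>\<close> is represented by its extension
  by \<open>0\<close> to the whole type.
\<close>

definition seq_norm :: "(('w \<Rightarrow> 'k) \<Rightarrow> ('w \<Rightarrow> 'k) \<Rightarrow> 'k::rc_field) \<Rightarrow> ('w \<Rightarrow> 'k) \<Rightarrow> real" where
  "seq_norm ipZ f = sqrt (norm (ipZ f f))"

text \<open>
  The form \<open>ipZ\<close> is only required to be definite up to almost-everywhere equality: a
  sequence of norm \<open>0\<close> vanishes almost everywhere. This covers spaces of genuine functions, as
  well as spaces whose elements are functions with almost everywhere equal ones identified.
\<close>

locale hilbert_sequence_space =
  fixes M :: "'w measure"
    and Z :: "('w \<Rightarrow> 'k::rc_field) set"
    and ipZ :: "('w \<Rightarrow> 'k) \<Rightarrow> ('w \<Rightarrow> 'k) \<Rightarrow> 'k"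
  assumes indexed: "f \<in> Z \<Longrightarrow> w \<notin> space M \<Longrightarrow> f w = 0"
    and zero_mem: "(\<lambda>_. 0) \<in> Z"
    and add_mem: "f \<in> Z \<Longrightarrow> g \<in> Z \<Longrightarrow> (\<lambda>w. f w + g w) \<in> Z"
    and scale_mem: "f \<in> Z \<Longrightarrow> (\<lambda>w. a * f w) \<in> Z"
    and ipZ_add_left: "f \<in> Z \<Longrightarrow> g \<in> Z \<Longrightarrow> h \<in> Z \<Longrightarrow> ipZ (\<lambda>w. f w + g w) h = ipZ f h + ipZ g h"
    and ipZ_scale_left: "f \<in> Z \<Longrightarrow> g \<in> Z \<Longrightarrow> ipZ (\<lambda>w. a * f w) g = a * ipZ f g"
    and ipZ_conj: "f \<in> Z \<Longrightarrow> g \<in> Z \<Longrightarrow> ipZ g f = rc_cnj (ipZ f g)"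
    and ipZ_nonneg: "f \<in> Z \<Longrightarrow> ipZ f f \<in> of_real ` {0..}"
    and ipZ_definite: "f \<in> Z \<Longrightarrow> ipZ f f = 0 \<Longrightarrow> AE w in M. f w = 0"
    and complete: "(\<And>n::nat. u n \<in> Z) \<Longrightarrow>
      (\<And>e. e > 0 \<Longrightarrow> \<exists>N. \<forall>m\<ge>N. \<forall>n\<ge>N. seq_norm ipZ (\<lambda>w. u m w - u n w) < e) \<Longrightarrow>
      \<exists>f\<in>Z. (\<lambda>n. seq_norm ipZ (\<lambda>w. u n w - f w)) \<longlonglongrightarrow> 0"

definition L2_seqs :: "'w measure \<Rightarrow> ('w \<Rightarrow> 'k::rc_field) set" where
  "L2_seqs M = {f. (\<forall>w. w \<notin> space M \<longrightarrow> f w = 0) \<and> f \<in> borel_measurable M \<and>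
                   integrable M (\<lambda>w. (norm (f w))\<^sup>2)}"

definition L2_ip :: "'w measure \<Rightarrow> ('w \<Rightarrow> 'k) \<Rightarrow> ('w \<Rightarrow> 'k) \<Rightarrow> 'k::rc_field" where
  "L2_ip M f g = (LINT w|M. f w * rc_cnj (g w))"

definition L2_norm :: "'w measure \<Rightarrow> ('w \<Rightarrow> 'k::rc_field) \<Rightarrow> real" where
  "L2_norm M f = sqrt (LINT w|M. (norm (f w))\<^sup>2)"

lemma seq_norm_L2_ip:
  fixes f :: "'a \<Rightarrow> 'b::rc_field"
  shows "seq_norm (L2_ip M) f = L2_norm M f"
proof -
  let ?g = "\<lambda>w. (norm (f w))\<^sup>2"
  have "L2_ip M f f = (LINT w|M. ?g w *\<^sub>R 1)"
    by (simp only: L2_ip_def mult_rc_cnj_self)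
  also have "\<dots> = (LINT w|M. ?g w) *\<^sub>R 1"
  proof (cases "integrable M ?g")
    case False
    have "integrable M ?g" if "integrable M (\<lambda>w. ?g w *\<^sub>R (1 :: 'b))"
      using integrable_norm[OF that] by simp
    with False have "\<not> integrable M (\<lambda>w. ?g w *\<^sub>R (1 :: 'b))"
      by blast
    with False show ?thesis
      using not_integrable_integral_eq[of M ?g]
        not_integrable_integral_eq[of M "\<lambda>w. ?g w *\<^sub>R (1 :: 'b)"]
      by (metis scaleR_zero_left)
  qed (rule integral_scaleR_left)
  finally show ?thesis
    by (simp add: seq_norm_def L2_norm_def integral_nonneg_AE)
qed

section \<open>Retro frames and their duals\<close>

definition analysis ::
  "'w measure \<Rightarrow> ('h \<Rightarrow> 'h \<Rightarrow> 'k::rc_field) \<Rightarrow> ('w \<Rightarrow> 'h) \<Rightarrow> 'h \<Rightarrow> 'w \<Rightarrow> 'k" where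
  "analysis M ip F x = (\<lambda>w. if w \<in> space M then ip x (F w) else 0)"

text \<open>The space \<open>\<A>\<^sub>d\<close>; its inner product is \<^const>\<open>L2_ip\<close>, its norm \<^const>\<open>L2_norm\<close>.\<close>

definition analysis_space ::
  "'w measure \<Rightarrow> ('h \<Rightarrow> 'h \<Rightarrow> 'k::rc_field) \<Rightarrow> ('w \<Rightarrow> 'h) \<Rightarrow> ('w \<Rightarrow> 'k) set" where
  "analysis_space M ip G = {analysis M ip G y | y. True}"

definition bounded_linear_from_seqs ::
  "('k::rc_field \<Rightarrow> 'h::banach \<Rightarrow> 'h) \<Rightarrow> ('w \<Rightarrow> 'k) set \<Rightarrow> (('w \<Rightarrow> 'k) \<Rightarrow> ('w \<Rightarrow> 'k) \<Rightarrow> 'k) \<Rightarrow>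
    (('w \<Rightarrow> 'k) \<Rightarrow> 'h) \<Rightarrow> bool" where
  "bounded_linear_from_seqs smul Z ipZ \<Theta> \<longleftrightarrow>
     (\<forall>f\<in>Z. \<forall>g\<in>Z. \<Theta> (\<lambda>w. f w + g w) = \<Theta> f + \<Theta> g) \<and>
     (\<forall>a. \<forall>f\<in>Z. \<Theta> (\<lambda>w. a * f w) = smul a (\<Theta> f)) \<and>
     (\<exists>C. \<forall>f\<in>Z. norm (\<Theta> f) \<le> C * seq_norm ipZ f)"

text \<open>Measurability of the coefficients is what makes the integral in the frame inequality
  meaningful.\<close>

definition retro_frame ::
  "'w measure \<Rightarrow> ('k::rc_field \<Rightarrow> 'h::banach \<Rightarrow> 'h) \<Rightarrow> ('h \<Rightarrow> 'h \<Rightarrow> 'k) \<Rightarrow>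
    ('w \<Rightarrow> 'k) set \<Rightarrow> (('w \<Rightarrow> 'k) \<Rightarrow> ('w \<Rightarrow> 'k) \<Rightarrow> 'k) \<Rightarrow> ('w \<Rightarrow> 'h) \<Rightarrow> (('w \<Rightarrow> 'k) \<Rightarrow> 'h) \<Rightarrow> bool" where
  "retro_frame M smul ip Z ipZ F \<Theta> \<longleftrightarrow>
     hilbert_sequence_space M Z ipZ \<and>
     (\<forall>x. analysis M ip F x \<in> Z) \<and>
     (\<forall>x. (\<lambda>w. ip x (F w)) \<in> borel_measurable M) \<and>
     (\<exists>A\<^sub>0 B\<^sub>0. 0 < A\<^sub>0 \<and> A\<^sub>0 \<le> B\<^sub>0 \<and>
        (\<forall>x. ennreal (A\<^sub>0 * (norm x)\<^sup>2) \<le> (\<integral>\<^sup>+w. ennreal ((norm (ip x (F w)))\<^sup>2) \<partial>M) \<and>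
             (\<integral>\<^sup>+w. ennreal ((norm (ip x (F w)))\<^sup>2) \<partial>M) \<le> ennreal (B\<^sub>0 * (norm x)\<^sup>2))) \<and>
     bounded_linear_from_seqs smul Z ipZ \<Theta> \<and>
     (\<forall>x. \<Theta> (analysis M ip F x) = x)"

text \<open>``For almost all \<open>w\<close> and almost all \<open>w\<^sub>0\<close>'' is read as: for almost every fixed
  \<open>w\<^sub>0 \<notin> \<Omega>\<^sub>0\<close>, the equation holds for almost all \<open>w\<close>.\<close>

definition biorthogonal_off ::
  "'w measure \<Rightarrow> ('h \<Rightarrow> 'h \<Rightarrow> 'k::rc_field) \<Rightarrow> 'w set \<Rightarrow> ('w \<Rightarrow> 'h) \<Rightarrow> ('w \<Rightarrow> 'h) \<Rightarrow> bool" where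
  "biorthogonal_off M ip \<Omega>\<^sub>0 F G \<longleftrightarrow>
     (AE w\<^sub>0 in M. w\<^sub>0 \<notin> \<Omega>\<^sub>0 \<longrightarrow> (AE w in M. ip (G w\<^sub>0) (F w) = (if w\<^sub>0 = w then 1 else 0)))"

text \<open>\<open>(G, \<Theta>')\<close> is an \<open>\<Omega>\<^sub>0\<close>-dual of the retro frame with vectors \<open>F\<close>, with respect to the
  sequence space \<open>Z'\<close>.\<close>

definition dual_retro_frame ::
  "'w measure \<Rightarrow> ('k::rc_field \<Rightarrow> 'h::banach \<Rightarrow> 'h) \<Rightarrow> ('h \<Rightarrow> 'h \<Rightarrow> 'k) \<Rightarrow> 'w set \<Rightarrow> ('w \<Rightarrow> 'h) \<Rightarrow>
    ('w \<Rightarrow> 'k) set \<Rightarrow> (('w \<Rightarrow> 'k) \<Rightarrow> ('w \<Rightarrow> 'k) \<Rightarrow> 'k) \<Rightarrow> ('w \<Rightarrow> 'h) \<Rightarrow> (('w \<Rightarrow> 'k) \<Rightarrow> 'h) \<Rightarrow> bool" where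
  "dual_retro_frame M smul ip \<Omega>\<^sub>0 F Z' ipZ' G \<Theta>' \<longleftrightarrow>
     biorthogonal_off M ip \<Omega>\<^sub>0 F G \<and> retro_frame M smul ip Z' ipZ' G \<Theta>'"

text \<open>
  Bounded below continuous linear operators \<open>U\<close> from the Hilbert space onto a space \<open>A\<close> of
  sequences normed by \<^const>\<open>L2_norm\<close>. The first clause says that \<open>A\<close> is indeed normed this way:
  the Bochner integral of a function that is not integrable would be \<open>0\<close>.
\<close>

definition bounded_below_continuous_linear_onto ::
  "'w measure \<Rightarrow> ('k::rc_field \<Rightarrow> 'h::banach \<Rightarrow> 'h) \<Rightarrow> ('w \<Rightarrow> 'k) set \<Rightarrow> ('h \<Rightarrow> 'w \<Rightarrow> 'k) \<Rightarrow> bool" where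
  "bounded_below_continuous_linear_onto M smul A U \<longleftrightarrow>
     A \<subseteq> L2_seqs M \<and>
     range U = A \<and>
     (\<forall>x y. U (x + y) = (\<lambda>w. U x w + U y w)) \<and>
     (\<forall>a x. U (smul a x) = (\<lambda>w. a * U x w)) \<and>
     (\<forall>y. ((\<lambda>x. L2_norm M (\<lambda>w. U x w - U y w)) \<longlongrightarrow> 0) (at y)) \<and>
     (\<exists>c>0. \<forall>y. c * norm y \<le> L2_norm M (U y))"

end

theory Submission
  imports Defs
begin

text \<open>
  The equivalence holds for each fixed system \<open>G\<close>, because both of its sides say the same two
  things about the analysis operator \<open>U\<close> of \<open>G\<close>: it takes values in \<open>L\<^sup>2(\<mu>)\<close>, and there are
  \<open>c > 0\<close> and \<open>B\<close> with \<open>c \<parallel>y\<parallel> \<le> \<parallel>U y\<parallel> \<le> B \<parallel>y\<parallel>\<close>. The biorthogonality condition is carried along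
  unchanged.

  For operators this is the usual fact that a linear map is continuous exactly when it is bounded
  (\<open>bounded_below_continuous_linear_onto_analysis_iff\<close>). For retro frames, the two bounds are the
  square roots of the frame inequality, so what needs proof is that they already provide the
  remaining data (\<open>retro_frame_analysis_space_iff\<close>). Since \<open>U\<close> is bounded below, it is injective with
  a bounded inverse \<open>\<A>\<^sub>d \<rightarrow> \<H>\<close>, and this inverse is the reconstruction operator. The space
  \<open>\<A>\<^sub>d\<close> is complete for the same reason: the preimages of a Cauchy sequence in \<open>\<A>\<^sub>d\<close> form a Cauchy
  sequence in \<open>\<H>\<close>, and \<open>U\<close> carries their limit back to a limit in \<open>\<A>\<^sub>d\<close>.
\<close>

section \<open>Conjugation is a real-linear isometry\<close>

lemma rc_cnj_0 [simp]: "rc_cnj (0 :: 'k::rc_field) = 0"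
  using rc_cnj_add[of "0 :: 'k" 0] by simp

lemma norm_rc_cnj [simp]: "norm (rc_cnj (x :: 'k::rc_field)) = norm x"
proof (cases "x = 0")
  case False
  have "norm x * norm (rc_cnj x) = norm x * norm x"
    by (simp add: norm_mult[symmetric] mult_rc_cnj_self power2_eq_square)
  with False show ?thesis by simp
qed simp

text \<open>Real scalars are fixed, since \<open>r \<cdot> cnj r = r\<^sup>2\<close> determines the conjugate of \<open>r \<noteq> 0\<close>.\<close>

lemma rc_cnj_of_real [simp]: "rc_cnj (of_real r :: 'k::rc_field) = of_real r"
proof (cases "r = 0")
  case False
  have "of_real r * rc_cnj (of_real r :: 'k) = of_real r * of_real r"
    unfolding mult_rc_cnj_self by (simp add: scaleR_conv_of_real power2_eq_square)
  with False show ?thesis by simp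
qed simp

lemma bounded_linear_rc_cnj: "bounded_linear (rc_cnj :: 'k::rc_field \<Rightarrow> 'k)"
proof (rule bounded_linear_intro)
  fix x y :: 'k and r :: real
  show "rc_cnj (x + y) = rc_cnj x + rc_cnj y" by (rule rc_cnj_add)
  show "rc_cnj (r *\<^sub>R x) = r *\<^sub>R rc_cnj x"
    by (simp add: scaleR_conv_of_real rc_cnj_mult)
  show "norm (rc_cnj x) \<le> norm x * 1" by simp
qed

lemma borel_measurable_rc_cnj [measurable]:
  "(rc_cnj :: 'k::rc_field \<Rightarrow> 'k) \<in> borel_measurable borel"
  by (intro borel_measurable_continuous_onI linear_continuous_on bounded_linear_rc_cnj)

section \<open>Square-integrable sequences\<close>

lemma L2_norm_nonneg [simp]: "0 \<le> L2_norm M f"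
  by (simp add: L2_norm_def integral_nonneg_AE)

lemma L2_norm_scale:
  fixes f :: "'w \<Rightarrow> 'k::rc_field"
  shows "L2_norm M (\<lambda>w. a * f w) = norm a * L2_norm M f"
  by (simp add: L2_norm_def norm_mult power_mult_distrib real_sqrt_mult)

lemma nn_integral_norm_square:
  fixes f :: "'w \<Rightarrow> 'k::rc_field"
  assumes "f \<in> L2_seqs M"
  shows "(\<integral>\<^sup>+w. ennreal ((norm (f w))\<^sup>2) \<partial>M) = ennreal ((L2_norm M f)\<^sup>2)"
  using assms by (simp add: L2_seqs_def L2_norm_def nn_integral_eq_integral integral_nonneg_AE)

lemma L2_seqsI:
  fixes f :: "'w \<Rightarrow> 'k::rc_field"
  assumes "\<And>w. w \<notin> space M \<Longrightarrow> f w = 0" "f \<in> borel_measurable M"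
    and "(\<integral>\<^sup>+w. ennreal ((norm (f w))\<^sup>2) \<partial>M) < \<infinity>"
  shows "f \<in> L2_seqs M"
  using assms by (auto simp: L2_seqs_def intro!: integrableI_nonneg)

text \<open>The products are dominated by \<open>|f|\<^sup>2 + |g|\<^sup>2\<close>.\<close>

lemma integrable_mult_rc_cnj:
  fixes f g :: "'w \<Rightarrow> 'k::rc_field"
  assumes "f \<in> L2_seqs M" "g \<in> L2_seqs M"
  shows "integrable M (\<lambda>w. f w * rc_cnj (g w))"
proof (rule Bochner_Integration.integrable_bound)
  have meas: "f \<in> borel_measurable M" "g \<in> borel_measurable M"
    using assms by (auto simp: L2_seqs_def)
  show "integrable M (\<lambda>w. (norm (f w))\<^sup>2 + (norm (g w))\<^sup>2)"
    using assms by (simp add: L2_seqs_def)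
  show "(\<lambda>w. f w * rc_cnj (g w)) \<in> borel_measurable M"
    using meas by measurable
  show "AE w in M. norm (f w * rc_cnj (g w)) \<le> norm ((norm (f w))\<^sup>2 + (norm (g w))\<^sup>2)"
  proof (rule AE_I2)
    fix w
    have "0 \<le> (norm (f w) - norm (g w))\<^sup>2" "0 \<le> norm (f w) * norm (g w)" by simp_all
    then have "norm (f w) * norm (g w) \<le> (norm (f w))\<^sup>2 + (norm (g w))\<^sup>2"
      unfolding power2_diff by linarith
    then show "norm (f w * rc_cnj (g w)) \<le> norm ((norm (f w))\<^sup>2 + (norm (g w))\<^sup>2)"
      by (simp add: norm_mult)
  qed
qed

lemma L2_ip_self:
  fixes f :: "'w \<Rightarrow> 'k::rc_field"
  assumes "f \<in> L2_seqs M"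
  shows "L2_ip M f f = of_real ((L2_norm M f)\<^sup>2)"
  using assms
  by (simp add: L2_ip_def L2_norm_def L2_seqs_def mult_rc_cnj_self
      integral_nonneg_AE of_real_def[symmetric] del: of_real_power)

lemma AE_eq_0_if_L2_norm_eq_0:
  fixes f :: "'w \<Rightarrow> 'k::rc_field"
  assumes "f \<in> L2_seqs M" "L2_norm M f = 0"
  shows "AE w in M. f w = 0"
proof -
  have "(LINT w|M. (norm (f w))\<^sup>2) = 0"
    using assms(2) by (simp add: L2_norm_def)
  moreover have "integrable M (\<lambda>w. (norm (f w))\<^sup>2)"
    using assms(1) by (simp add: L2_seqs_def)
  ultimately have "AE w in M. (norm (f w))\<^sup>2 = 0"
    by (subst (asm) integral_nonneg_eq_0_iff_AE) auto
  then show ?thesis by simp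
qed

text \<open>
  The axioms about the inner product are inherited by every set of square-integrable sequences, so
  such a set can fail to be a Hilbert sequence space only by not being a subspace or not being
  complete.
\<close>

lemma hilbert_sequence_space_L2I:
  fixes A :: "('w \<Rightarrow> 'k::rc_field) set"
  assumes L2: "A \<subseteq> L2_seqs M"
    and "(\<lambda>_. 0) \<in> A"
    and "\<And>f g. f \<in> A \<Longrightarrow> g \<in> A \<Longrightarrow> (\<lambda>w. f w + g w) \<in> A"
    and "\<And>a f. f \<in> A \<Longrightarrow> (\<lambda>w. a * f w) \<in> A"
    and complete: "\<And>u. (\<And>n::nat. u n \<in> A) \<Longrightarrow>
      (\<And>e. e > 0 \<Longrightarrow> \<exists>N. \<forall>m\<ge>N. \<forall>n\<ge>N. L2_norm M (\<lambda>w. u m w - u n w) < e) \<Longrightarrow>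
      \<exists>f\<in>A. (\<lambda>n. L2_norm M (\<lambda>w. u n w - f w)) \<longlonglongrightarrow> 0"
  shows "hilbert_sequence_space M A (L2_ip M)"
proof
  note int = integrable_mult_rc_cnj[OF subsetD[OF L2] subsetD[OF L2]]
  fix f g h :: "'w \<Rightarrow> 'k" and w a
  assume f: "f \<in> A"
  show "w \<notin> space M \<Longrightarrow> f w = 0"
    using f L2 by (auto simp: L2_seqs_def)
  show "L2_ip M f f \<in> of_real ` {0..}"
    using f L2 by (auto simp: L2_ip_self simp del: of_real_power)
  show "L2_ip M f f = 0 \<Longrightarrow> AE w in M. f w = 0"
    using f L2 AE_eq_0_if_L2_norm_eq_0[of f M] by (auto simp: L2_ip_self)
  assume g: "g \<in> A"
  show "L2_ip M (\<lambda>w. a * f w) g = a * L2_ip M f g"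
    by (simp add: L2_ip_def mult.assoc)
  have "L2_ip M g f = (LINT w|M. rc_cnj (f w * rc_cnj (g w)))"
    by (simp add: L2_ip_def rc_cnj_mult rc_cnj_rc_cnj mult.commute)
  also have "\<dots> = rc_cnj (L2_ip M f g)"
    unfolding L2_ip_def by (rule integral_bounded_linear[OF bounded_linear_rc_cnj int[OF f g]])
  finally show "L2_ip M g f = rc_cnj (L2_ip M f g)" .
  assume h: "h \<in> A"
  show "L2_ip M (\<lambda>w. f w + g w) h = L2_ip M f h + L2_ip M g h"
    using int[OF f h] int[OF g h] by (simp add: L2_ip_def distrib_right)
qed (use assms in \<open>auto simp: seq_norm_L2_ip\<close>)

section \<open>The analysis operator\<close>

context hilbert_space
begin

lemma analysis_add: "analysis M ip G (x + y) = (\<lambda>w. analysis M ip G x w + analysis M ip G y w)"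
  by (auto simp: analysis_def ip_add_left)

lemma analysis_scale: "analysis M ip G (smul a x) = (\<lambda>w. a * analysis M ip G x w)"
  by (auto simp: analysis_def ip_scale_left)

lemma analysis_diff: "analysis M ip G (x - y) = (\<lambda>w. analysis M ip G x w - analysis M ip G y w)"
  using analysis_add[of M G "x - y" y] by (auto simp: fun_eq_iff)

lemma analysis_zero: "analysis M ip G 0 = (\<lambda>_. 0)"
  using analysis_diff[of M G 0 0] by simp

lemma L2_norm_analysis_scaleR:
  "L2_norm M (analysis M ip G (r *\<^sub>R x)) = \<bar>r\<bar> * L2_norm M (analysis M ip G x)"
  by (simp add: scale_of_real[symmetric] analysis_scale L2_norm_scale)

lemma bounded_below_continuous_linear_onto_analysis_iff:
  "bounded_below_continuous_linear_onto M smul (analysis_space M ip G) (analysis M ip G) \<longleftrightarrow>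
     analysis_space M ip G \<subseteq> L2_seqs M \<and>
     (\<exists>c>0. \<forall>y. c * norm y \<le> L2_norm M (analysis M ip G y)) \<and>
     (\<exists>B. \<forall>y. L2_norm M (analysis M ip G y) \<le> B * norm y)"
    (is "_ \<longleftrightarrow> _ \<and> _ \<and> ?bounded")
proof -
  let ?U = "analysis M ip G"
  have "(\<forall>y. ((\<lambda>x. L2_norm M (\<lambda>w. ?U x w - ?U y w)) \<longlongrightarrow> 0) (at y)) \<longleftrightarrow> ?bounded"
  proof
    assume "\<forall>y. ((\<lambda>x. L2_norm M (\<lambda>w. ?U x w - ?U y w)) \<longlongrightarrow> 0) (at y)"
    then have "((\<lambda>x. L2_norm M (?U x)) \<longlongrightarrow> 0) (at 0)"
      by (auto dest: spec[of _ 0] simp: analysis_zero)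
    then have "eventually (\<lambda>x. L2_norm M (?U x) < 1) (at 0)"
      by (rule order_tendstoD) simp
    then obtain d where d: "d > 0" "\<And>x. x \<noteq> 0 \<Longrightarrow> norm x < d \<Longrightarrow> L2_norm M (?U x) < 1"
      by (auto simp: eventually_at)
    have "L2_norm M (?U y) \<le> 2 / d * norm y" for y
    proof (cases "y = 0")
      case True
      then show ?thesis by (simp add: analysis_zero L2_norm_def)
    next
      case False
      \<comment> \<open>Rescale \<open>y\<close> to norm \<open>d / 2\<close>, inside the ball on which the values stay below \<open>1\<close>.\<close>
      define r where "r = d / (2 * norm y)"
      have "r > 0" "norm (r *\<^sub>R y) < d" "r *\<^sub>R y \<noteq> 0"
        using d(1) False by (auto simp: r_def)
      with d(2)[of "r *\<^sub>R y"] have "r * L2_norm M (?U y) < 1"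
        by (simp add: L2_norm_analysis_scaleR)
      with d(1) False show ?thesis by (simp add: r_def field_simps)
    qed
    then show ?bounded by blast
  next
    assume ?bounded
    then obtain B where B: "\<And>y. L2_norm M (?U y) \<le> B * norm y" by blast
    show "\<forall>y. ((\<lambda>x. L2_norm M (\<lambda>w. ?U x w - ?U y w)) \<longlongrightarrow> 0) (at y)"
    proof
      fix y :: 'h
      have "((\<lambda>x. B * norm (x - y)) \<longlongrightarrow> B * norm (y - y)) (at y)"
        by (intro tendsto_intros)
      then have lim: "((\<lambda>x. B * norm (x - y)) \<longlongrightarrow> 0) (at y)" by simp
      show "((\<lambda>x. L2_norm M (\<lambda>w. ?U x w - ?U y w)) \<longlongrightarrow> 0) (at y)"
        by (rule tendsto_sandwich[OF _ _ tendsto_const lim])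
          (auto simp: analysis_diff[symmetric] B)
    qed
  qed
  moreover have "range ?U = analysis_space M ip G"
    by (auto simp: analysis_space_def)
  ultimately show ?thesis
    unfolding bounded_below_continuous_linear_onto_def
    by (auto simp: analysis_add analysis_scale)
qed

text \<open>
  The upper bound keeps \<open>U\<close> continuous, so that it maps limits to limits; the lower bound makes
  Cauchy sequences of values come from Cauchy sequences of arguments.
\<close>

lemma hilbert_sequence_space_analysis_space:
  fixes M :: "'w measure"
  assumes L2: "analysis_space M ip G \<subseteq> L2_seqs M"
    and c: "c > 0" "\<And>y. c * norm y \<le> L2_norm M (analysis M ip G y)"
    and B: "\<And>y. L2_norm M (analysis M ip G y) \<le> B * norm y"
  shows "hilbert_sequence_space M (analysis_space M ip G) (L2_ip M)"
proof (rule hilbert_sequence_space_L2I[OF L2])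
  let ?U = "analysis M ip G"
  show "(\<lambda>_. 0) \<in> analysis_space M ip G"
    unfolding analysis_space_def using analysis_zero[of M G] by (metis (mono_tags) mem_Collect_eq)
  show "(\<lambda>w. f w + g w) \<in> analysis_space M ip G"
    if "f \<in> analysis_space M ip G" "g \<in> analysis_space M ip G" for f g
    using that unfolding analysis_space_def by (auto simp: analysis_add[symmetric])
  show "(\<lambda>w. a * f w) \<in> analysis_space M ip G" if "f \<in> analysis_space M ip G" for a f
    using that unfolding analysis_space_def by (auto simp: analysis_scale[symmetric])
  fix u :: "nat \<Rightarrow> 'w \<Rightarrow> 'k"
  assume "\<And>n. u n \<in> analysis_space M ip G"
    and Cauchy_u: "\<And>e. e > 0 \<Longrightarrow> \<exists>N. \<forall>m\<ge>N. \<forall>n\<ge>N. L2_norm M (\<lambda>w. u m w - u n w) < e"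
  then have "\<exists>y. \<forall>n. u n = ?U (y n)"
    unfolding analysis_space_def by (intro choice) auto
  then obtain y where u: "\<And>n. u n = ?U (y n)" by blast
  have "Cauchy y"
    unfolding Cauchy_iff
  proof (intro allI impI)
    fix e :: real assume "e > 0"
    with c(1) have "c * e > 0" by simp
    then obtain N where N: "\<And>m n. m \<ge> N \<Longrightarrow> n \<ge> N \<Longrightarrow> L2_norm M (?U (y m - y n)) < c * e"
      using Cauchy_u[of "c * e"] by (auto simp: u analysis_diff)
    have "norm (y m - y n) < e" if "m \<ge> N" "n \<ge> N" for m n
      using N[OF that] c(2)[of "y m - y n"] c(1) by (meson le_less_trans mult_less_cancel_left_pos)
    then show "\<exists>N. \<forall>m\<ge>N. \<forall>n\<ge>N. norm (y m - y n) < e" by blast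
  qed
  then obtain l where "y \<longlonglongrightarrow> l"
    using Cauchy_convergent convergent_def by blast
  then have "(\<lambda>n. B * norm (y n - l)) \<longlonglongrightarrow> B * norm (l - l)"
    by (intro tendsto_intros)
  then have lim: "(\<lambda>n. B * norm (y n - l)) \<longlonglongrightarrow> 0" by simp
  have "(\<lambda>n. L2_norm M (\<lambda>w. u n w - ?U l w)) \<longlonglongrightarrow> 0"
    by (rule tendsto_sandwich[OF _ _ tendsto_const lim])
      (auto simp: u analysis_diff[symmetric] B)
  then show "\<exists>f\<in>analysis_space M ip G. (\<lambda>n. L2_norm M (\<lambda>w. u n w - f w)) \<longlonglongrightarrow> 0"
    unfolding analysis_space_def by blast
qed

lemma bounded_linear_from_analysis_space_inv:
  assumes c: "c > 0" "\<And>y. c * norm y \<le> L2_norm M (analysis M ip G y)"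
  shows "\<exists>\<Theta>. bounded_linear_from_seqs smul (analysis_space M ip G) (L2_ip M) \<Theta> \<and>
              (\<forall>x. \<Theta> (analysis M ip G x) = x)"
proof -
  let ?U = "analysis M ip G"
  have "inj ?U"
  proof (rule injI)
    fix x y assume "?U x = ?U y"
    then have "L2_norm M (?U (x - y)) = 0" by (simp add: analysis_diff L2_norm_def)
    with c(2)[of "x - y"] c(1) show "x = y" by (simp add: mult_le_0_iff)
  qed
  then have inv: "inv ?U (?U x) = x" for x by simp
  have "norm x \<le> 1 / c * L2_norm M (?U x)" for x
    using c(2)[of x] c(1) by (simp add: field_simps)
  then have "\<exists>C. \<forall>f\<in>analysis_space M ip G. norm (inv ?U f) \<le> C * seq_norm (L2_ip M) f"
    unfolding analysis_space_def seq_norm_L2_ip by (intro exI[of _ "1 / c"]) (auto simp: inv)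
  then have "bounded_linear_from_seqs smul (analysis_space M ip G) (L2_ip M) (inv ?U)"
    unfolding bounded_linear_from_seqs_def analysis_space_def
    by (auto simp: analysis_add[symmetric] analysis_scale[symmetric] inv)
  with inv show ?thesis by blast
qed

text \<open>
  Square integrability together with the norm bounds is the frame inequality; the completeness of
  the sequence space and the reconstruction operator come for free.
\<close>

lemma retro_frame_analysis_space_iff:
  "(\<exists>\<Theta>. retro_frame M smul ip (analysis_space M ip G) (L2_ip M) G \<Theta>) \<longleftrightarrow>
     analysis_space M ip G \<subseteq> L2_seqs M \<and>
     (\<exists>c>0. \<forall>y. c * norm y \<le> L2_norm M (analysis M ip G y)) \<and>
     (\<exists>B. \<forall>y. L2_norm M (analysis M ip G y) \<le> B * norm y)"
proof -
  let ?U = "analysis M ip G"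
  have meas: "(\<lambda>w. ip x (G w)) \<in> borel_measurable M \<longleftrightarrow> ?U x \<in> borel_measurable M" for x
    by (rule measurable_cong) (simp add: analysis_def)
  have nn: "(\<integral>\<^sup>+w. ennreal ((norm (ip x (G w)))\<^sup>2) \<partial>M) = (\<integral>\<^sup>+w. ennreal ((norm (?U x w))\<^sup>2) \<partial>M)"
    for x by (rule nn_integral_cong) (simp add: analysis_def)
  show ?thesis
  proof
    assume "\<exists>\<Theta>. retro_frame M smul ip (analysis_space M ip G) (L2_ip M) G \<Theta>"
    then obtain A\<^sub>0 B\<^sub>0 where AB: "0 < A\<^sub>0" "A\<^sub>0 \<le> B\<^sub>0"
      and lower: "\<And>x. ennreal (A\<^sub>0 * (norm x)\<^sup>2) \<le> (\<integral>\<^sup>+w. ennreal ((norm (?U x w))\<^sup>2) \<partial>M)"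
      and upper: "\<And>x. (\<integral>\<^sup>+w. ennreal ((norm (?U x w))\<^sup>2) \<partial>M) \<le> ennreal (B\<^sub>0 * (norm x)\<^sup>2)"
      and U_meas: "\<And>x. ?U x \<in> borel_measurable M"
      unfolding retro_frame_def nn meas by blast
    have L2: "?U x \<in> L2_seqs M" for x
      using upper[of x] U_meas[of x]
      by (intro L2_seqsI) (auto simp: analysis_def intro: le_less_trans)
    have "sqrt A\<^sub>0 * norm x \<le> L2_norm M (?U x)" for x
    proof (rule power2_le_imp_le)
      show "(sqrt A\<^sub>0 * norm x)\<^sup>2 \<le> (L2_norm M (?U x))\<^sup>2"
        using lower[of x] AB by (simp add: nn_integral_norm_square[OF L2] power_mult_distrib)
    qed simp
    moreover have "L2_norm M (?U x) \<le> sqrt B\<^sub>0 * norm x" for x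
    proof (rule power2_le_imp_le)
      show "(L2_norm M (?U x))\<^sup>2 \<le> (sqrt B\<^sub>0 * norm x)\<^sup>2"
        using upper[of x] AB by (simp add: nn_integral_norm_square[OF L2] power_mult_distrib)
      show "0 \<le> sqrt B\<^sub>0 * norm x" using AB by simp
    qed
    moreover have "sqrt A\<^sub>0 > 0" using AB by simp
    ultimately show "analysis_space M ip G \<subseteq> L2_seqs M \<and>
        (\<exists>c>0. \<forall>y. c * norm y \<le> L2_norm M (?U y)) \<and>
        (\<exists>B. \<forall>y. L2_norm M (?U y) \<le> B * norm y)"
      using L2 unfolding analysis_space_def by blast
  next
    assume "analysis_space M ip G \<subseteq> L2_seqs M \<and>
        (\<exists>c>0. \<forall>y. c * norm y \<le> L2_norm M (?U y)) \<and>
        (\<exists>B. \<forall>y. L2_norm M (?U y) \<le> B * norm y)"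
    then obtain c B where A_L2: "analysis_space M ip G \<subseteq> L2_seqs M"
      and c: "c > 0" "\<And>y. c * norm y \<le> L2_norm M (?U y)"
      and B: "\<And>y. L2_norm M (?U y) \<le> B * norm y" by blast
    have L2: "?U x \<in> L2_seqs M" for x
      using A_L2 unfolding analysis_space_def by blast
    \<comment> \<open>The maximum secures \<open>A\<^sub>0 \<le> B\<^sub>0\<close>, which \<open>c\<close> and \<open>B\<close> themselves need not give if \<open>\<H> = 0\<close>.\<close>
    let ?A0 = "c\<^sup>2" and ?B0 = "max (c\<^sup>2) (B\<^sup>2)"
    have "?A0 * (norm x)\<^sup>2 \<le> (L2_norm M (?U x))\<^sup>2" for x
      using power_mono[OF c(2)[of x], of 2] c(1) by (simp add: power_mult_distrib)
    moreover have "(L2_norm M (?U x))\<^sup>2 \<le> ?B0 * (norm x)\<^sup>2" for x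
    proof -
      have "(L2_norm M (?U x))\<^sup>2 \<le> B\<^sup>2 * (norm x)\<^sup>2"
        using power_mono[OF B[of x], of 2] by (simp add: power_mult_distrib)
      also have "\<dots> \<le> ?B0 * (norm x)\<^sup>2" by (intro mult_right_mono) auto
      finally show ?thesis .
    qed
    ultimately have "\<exists>A\<^sub>0 B\<^sub>0. 0 < A\<^sub>0 \<and> A\<^sub>0 \<le> B\<^sub>0 \<and>
        (\<forall>x. ennreal (A\<^sub>0 * (norm x)\<^sup>2) \<le> (\<integral>\<^sup>+w. ennreal ((norm (?U x w))\<^sup>2) \<partial>M) \<and>
             (\<integral>\<^sup>+w. ennreal ((norm (?U x w))\<^sup>2) \<partial>M) \<le> ennreal (B\<^sub>0 * (norm x)\<^sup>2))"
      using c(1) unfolding nn_integral_norm_square[OF L2]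
      by (intro exI[of _ ?A0] exI[of _ ?B0]) (auto intro: ennreal_leI)
    moreover have "?U x \<in> analysis_space M ip G" "?U x \<in> borel_measurable M" for x
      using L2[of x] by (auto simp: analysis_space_def L2_seqs_def)
    ultimately show "\<exists>\<Theta>. retro_frame M smul ip (analysis_space M ip G) (L2_ip M) G \<Theta>"
      using hilbert_sequence_space_analysis_space[OF A_L2 c B]
        bounded_linear_from_analysis_space_inv[OF c]
      unfolding retro_frame_def nn meas by blast
  qed
qed

end

section \<open>Existence of duals\<close>

theorem theorem3p13:
  fixes M :: "'w measure"
    and \<Omega>\<^sub>0 :: "'w set"
    and smul :: "'k::rc_field \<Rightarrow> 'h::banach \<Rightarrow> 'h"
    and ip :: "'h \<Rightarrow> 'h \<Rightarrow> 'k"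
    and Z :: "('w \<Rightarrow> 'k) set"
    and ipZ :: "('w \<Rightarrow> 'k) \<Rightarrow> ('w \<Rightarrow> 'k) \<Rightarrow> 'k"
    and F :: "'w \<Rightarrow> 'h"
    and \<Theta> :: "('w \<Rightarrow> 'k) \<Rightarrow> 'h"
  assumes "\<Omega>\<^sub>0 \<subseteq> space M"
    and "hilbert_space smul ip"
    and "infinite_dimensional smul"
    and "retro_frame M smul ip Z ipZ F \<Theta>"
  shows "(\<exists>(G :: 'w \<Rightarrow> 'h) \<Theta>'.
            dual_retro_frame M smul ip \<Omega>\<^sub>0 F (analysis_space M ip G) (L2_ip M) G \<Theta>') \<longleftrightarrow>
         (\<exists>G :: 'w \<Rightarrow> 'h.
            biorthogonal_off M ip \<Omega>\<^sub>0 F G \<and>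
            bounded_below_continuous_linear_onto M smul (analysis_space M ip G) (analysis M ip G))"
proof -
  interpret hilbert_space smul ip by (rule assms(2))
  show ?thesis
    unfolding dual_retro_frame_def bounded_below_continuous_linear_onto_analysis_iff
      retro_frame_analysis_space_iff[symmetric]
    by simp
qed

end
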